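(* Let $K$ be a field of characteristic $0$, $q\in K^*$, and $n\ge 2$. Let $K\langle D\rangle$ be the free associative $K$-algebra on the set $D=\{D_{ij}\mid 1\le i,j\le n\}$, and let $S\subset K\langle D\rangle$ be the set consisting of the elements \begin{itemize} \item $f_{ijst}=D_{ij}D_{st}-qD_{st}D_{ij}$, for all $i,j,s,t$ with $i>s$ and $j\le t$; \item $g_{ijst}=D_{ij}D_{st}-D_{st}D_{ij}-(q-1)D_{sj}D_{it}$, for all $i,j,s,t$ with $i>s$ and $j>t$; \item $h_{ijik}=D_{ij}D_{ik}-D_{ik}D_{ij}$, for all $i,j,k$, \end{itemize} where all indices range over $\{1,\dots,n\}$. Let $J=\langle S\rangle$ be the two-sided ideal of $K\langle D\rangle$ generated by $S$, so that $D_q(n)\cong K\langle D\rangle/J$. Then, with respect to the degree-lexicographic monomial ordering $\prec_{d\text{-}lex}$ on $K\langle D\rangle$ (defined in the context), $S$ is a Gröbner–Shirshov basis of the ideal $J$.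
   Context: All algebras are associative with identity. $K^*=K\setminus\{0\}$. The quantized matrix algebra $D_q(n)$ of Dipper and Donkin is the $K$-algebra generated by $d_{ij}$ ($1\le i,j\le n$) subject to $d_{ij}d_{st}=qd_{st}d_{ij}$ if $i>s$, $j\le t$; $d_{ij}d_{st}=d_{st}d_{ij}+(q-1)d_{sj}d_{it}$ if $i>s$, $j>t$; $d_{ij}d_{ik}=d_{ik}d_{ij}$ for all $i,j,k$. The ordering $\prec_{d\text{-}lex}$: order the letters by $D_{kl}<D_{ij}$ iff $k<i$, or $k=i$ and $l<j$. Let $D^*$ be the set of all words of finite length in the letters of $D$ (including the empty word $1$), and let $|u|$ be the length of $u\in D^*$. Then $u\prec_{d\text{-}lex}v$ iff $|u|<|v|$, or $|u|=|v|$ and at the first position where $u$ and $v$ differ the letter of $u$ is smaller than the letter of $v$. This is a monomial ordering (a well-ordering compatible with left and right multiplication by words). For nonzero $f\in K\langle D\rangle$, $\overline f$ denotes the largest word, with respect to $\prec_{d\text{-}lex}$, occurring in $f$ with nonzero coefficient. A set $S$ is a Gröbner–Shirshov basis of the ideal $J=\langle S\rangle$ if for every nonzero $f\in J$ the word $\overline f$ contains $\overline s$ as a subword for some nonzero $s\in S$ (equivalently, all compositions of the nonzero elements of $S$, normalized to be monic, are trivial modulo $S$). *)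

theory Defs
  imports
    "HOL-Algebra.Ideal"
    "HOL-Library.Poly_Mapping"
    "HOL-Library.Sublist"
begin

section \<open>The free associative algebra on a set of letters\<close>

text \<open>Words form a monoid under concatenation, written additively because the convolution product
  of \<^theory>\<open>HOL-Library.Poly_Mapping\<close> expects an additive monoid of exponents.  Hence
  \<open>'a list \<Rightarrow>\<^sub>0 'k\<close> is the monoid algebra of the free monoid over \<open>'a\<close>, i.e. the free associative
  \<open>'k\<close>-algebra on all of \<open>'a\<close>.\<close>

instantiation list :: (type) monoid_add
begin

definition zero_list_def: "0 = ([] :: 'a list)"
definition plus_list_def: "u + v = (u @ v :: 'a list)"

instance
  by standard (simp_all add: zero_list_def plus_list_def)

end

definition free_alg :: "'a set \<Rightarrow> ('a list \<Rightarrow>\<^sub>0 'k::ring_1) ring" where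
  "free_alg X =
    \<lparr>carrier = {f. \<forall>w \<in> Poly_Mapping.keys f. set w \<subseteq> X}, mult = (*), one = 1, zero = 0, add = (+)\<rparr>"

definition const :: "'k \<Rightarrow> 'a list \<Rightarrow>\<^sub>0 'k::ring_1" where
  "const c = Poly_Mapping.single [] c"

definition letter :: "'a \<Rightarrow> 'a list \<Rightarrow>\<^sub>0 'k::ring_1" where
  "letter x = Poly_Mapping.single [x] 1"

lemma ring_free_alg: "ring (free_alg X :: ('a list \<Rightarrow>\<^sub>0 'k::ring_1) ring)"
proof (rule ringI)
  show "abelian_group (free_alg X :: ('a list \<Rightarrow>\<^sub>0 'k) ring)"
  proof (rule abelian_groupI)
    fix f g :: "'a list \<Rightarrow>\<^sub>0 'k"
    assume "f \<in> carrier (free_alg X)" "g \<in> carrier (free_alg X)"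
    then show "f \<oplus>\<^bsub>free_alg X\<^esub> g \<in> carrier (free_alg X)"
      using Poly_Mapping.keys_add[of f g] by (fastforce simp: free_alg_def)
  next
    fix f :: "'a list \<Rightarrow>\<^sub>0 'k"
    assume "f \<in> carrier (free_alg X)"
    then show "\<exists>g \<in> carrier (free_alg X). g \<oplus>\<^bsub>free_alg X\<^esub> f = \<zero>\<^bsub>free_alg X\<^esub>"
      by (intro bexI[of _ "- f"]) (auto simp: free_alg_def)
  qed (auto simp: free_alg_def algebra_simps)
next
  show "monoid (free_alg X :: ('a list \<Rightarrow>\<^sub>0 'k) ring)"
  proof (rule monoidI)
    fix f g :: "'a list \<Rightarrow>\<^sub>0 'k"
    assume "f \<in> carrier (free_alg X)" "g \<in> carrier (free_alg X)"
    then show "f \<otimes>\<^bsub>free_alg X\<^esub> g \<in> carrier (free_alg X)"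
      using Poly_Mapping.keys_mult[of f g] by (fastforce simp: free_alg_def plus_list_def)
  qed (auto simp: free_alg_def algebra_simps zero_list_def split: if_splits)
qed (auto simp: free_alg_def algebra_simps)


section \<open>Leading words and Groebner--Shirshov bases\<close>

definition lead_word :: "('a list \<times> 'a list) set \<Rightarrow> ('a list \<Rightarrow>\<^sub>0 'k::zero) \<Rightarrow> 'a list" where
  "lead_word ord f =
    (THE w. w \<in> Poly_Mapping.keys f \<and> (\<forall>v \<in> Poly_Mapping.keys f. v \<noteq> w \<longrightarrow> (v, w) \<in> ord))"

definition gs_basis ::
    "'a set \<Rightarrow> ('a list \<times> 'a list) set \<Rightarrow> ('a list \<Rightarrow>\<^sub>0 'k::ring_1) set \<Rightarrow> ('a list \<Rightarrow>\<^sub>0 'k) set \<Rightarrow> bool"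
  where
  "gs_basis X ord S J \<longleftrightarrow>
    S \<subseteq> carrier (free_alg X) \<and> J = genideal (free_alg X) S \<and>
    (\<forall>f \<in> J. f \<noteq> 0 \<longrightarrow> (\<exists>s \<in> S. s \<noteq> 0 \<and> sublist (lead_word ord s) (lead_word ord f)))"

text \<open>The pair \<open>(i, j)\<close> encodes the letter \<open>D\<^sub>i\<^sub>j\<close>; \<^const>\<open>lenlex\<close> compares lengths first and then
  the letters at the first position of difference.\<close>

definition dlex :: "((nat \<times> nat) list \<times> (nat \<times> nat) list) set" where
  "dlex = lenlex (less_than <*lex*> less_than)"

lemma wf_dlex: "wf dlex"
  unfolding dlex_def by (intro wf_lenlex wf_lex_prod wf_less_than)

lemma trans_dlex: "trans dlex"
  unfolding dlex_def by (intro lenlex_transI trans_lex_prod trans_less_than)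

lemma total_dlex: "total dlex"
  unfolding dlex_def by (intro total_lenlex total_lex_prod total_less_than)

lemma lead_word_dlex:
  assumes "f \<noteq> 0"
  shows "lead_word dlex f \<in> Poly_Mapping.keys f"
    and "v \<in> Poly_Mapping.keys f \<Longrightarrow> v \<noteq> lead_word dlex f \<Longrightarrow> (v, lead_word dlex f) \<in> dlex"
proof -
  let ?P = "\<lambda>w. w \<in> Poly_Mapping.keys f \<and> (\<forall>v \<in> Poly_Mapping.keys f. v \<noteq> w \<longrightarrow> (v, w) \<in> dlex)"
  have irr: "(w, w) \<notin> dlex" for w
    using wf_dlex by (simp add: wf_not_refl)
  have "\<exists>w \<in> A. \<forall>v \<in> A. v \<noteq> w \<longrightarrow> (v, w) \<in> dlex" if "finite A" "A \<noteq> {}" for A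
    using that
  proof (induction rule: finite_ne_induct)
    case (insert x F)
    then obtain w where w: "w \<in> F" "\<forall>v \<in> F. v \<noteq> w \<longrightarrow> (v, w) \<in> dlex"
      by auto
    have "x \<noteq> w"
      using insert.hyps w by auto
    then consider "(x, w) \<in> dlex" | "(w, x) \<in> dlex"
      using total_dlex by (auto simp: total_on_def)
    then show ?case
    proof cases
      case 1
      then show ?thesis using w by blast
    next
      case 2
      have "(v, x) \<in> dlex" if "v \<in> F" for v
        using w(2) that 2 trans_dlex by (cases "v = w") (auto dest: transD)
      then show ?thesis by blast
    qed
  qed simp
  from this[of "Poly_Mapping.keys f"] obtain w where w: "?P w"
    using assms by auto
  have uniq: "w' = w" if "?P w'" for w'
  proof (rule ccontr)
    assume "w' \<noteq> w"
    then have "(w, w') \<in> dlex" "(w', w) \<in> dlex"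
      using w that by auto
    then show False
      using irr transD[OF trans_dlex] by blast
  qed
  have "?P (lead_word dlex f)"
    unfolding lead_word_def by (rule theI[of ?P, OF w uniq])
  then show "lead_word dlex f \<in> Poly_Mapping.keys f"
    and "v \<in> Poly_Mapping.keys f \<Longrightarrow> v \<noteq> lead_word dlex f \<Longrightarrow> (v, lead_word dlex f) \<in> dlex"
    by auto
qed


section \<open>The defining relations of the Dipper--Donkin quantized matrix algebra\<close>

definition letters :: "nat \<Rightarrow> (nat \<times> nat) set" where
  "letters n = {1..n} \<times> {1..n}"

abbreviation D :: "nat \<Rightarrow> nat \<Rightarrow> (nat \<times> nat) list \<Rightarrow>\<^sub>0 'k::field" where
  "D i j \<equiv> letter (i, j)"

definition f_rel :: "'k::field \<Rightarrow> nat \<Rightarrow> nat \<Rightarrow> nat \<Rightarrow> nat \<Rightarrow> (nat \<times> nat) list \<Rightarrow>\<^sub>0 'k" where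
  "f_rel q i j s t = D i j * D s t - const q * D s t * D i j"

definition g_rel :: "'k::field \<Rightarrow> nat \<Rightarrow> nat \<Rightarrow> nat \<Rightarrow> nat \<Rightarrow> (nat \<times> nat) list \<Rightarrow>\<^sub>0 'k" where
  "g_rel q i j s t = D i j * D s t - D s t * D i j - const (q - 1) * D s j * D i t"

definition h_rel :: "nat \<Rightarrow> nat \<Rightarrow> nat \<Rightarrow> (nat \<times> nat) list \<Rightarrow>\<^sub>0 'k::field" where
  "h_rel i j k = D i j * D i k - D i k * D i j"

definition dd_relations :: "nat \<Rightarrow> 'k::field \<Rightarrow> ((nat \<times> nat) list \<Rightarrow>\<^sub>0 'k) set" where
  "dd_relations n q =
    {f_rel q i j s t | i j s t. {i, j, s, t} \<subseteq> {1..n} \<and> i > s \<and> j \<le> t} \<union>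
    {g_rel q i j s t | i j s t. {i, j, s, t} \<subseteq> {1..n} \<and> i > s \<and> j > t} \<union>
    {h_rel i j k | i j k. {i, j, k} \<subseteq> {1..n}}"

end

theory Submission
  imports Defs
begin

text \<open>
  The relations rewrite every descent \<open>x y\<close> with \<open>x > y\<close> into smaller words, so the leading words of
  \<open>S\<close> are exactly the descents.  Following Bergman's diamond lemma in dual form, for each word \<open>m\<close>
  one builds by well-founded recursion a linear functional on words: the coefficient of \<open>m\<close> in the
  normal form obtained by rewriting some chosen descent.  Resolving the overlaps \<open>x y z\<close> with
  \<open>x > y > z\<close> shows that the choice of descent does not matter, so the functional vanishes on \<open>J\<close>.  It
  also vanishes on all words below \<open>m\<close>, and it is \<open>1\<close> on \<open>m\<close> if \<open>m\<close> has no descent.  Hence such an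
  \<open>m\<close> is never the leading word of an element of \<open>J\<close>.
\<close>

section \<open>Rewriting a descent and its compatibility with the ordering\<close>

definition letter_less :: "nat \<times> nat \<Rightarrow> nat \<times> nat \<Rightarrow> bool" where
  "letter_less x y \<longleftrightarrow> fst x < fst y \<or> fst x = fst y \<and> snd x < snd y"

text \<open>For \<open>x > y\<close>, \<open>swap q x y \<psi>\<close> is the value of the linear extension of \<open>\<psi>\<close>, a function of
  two-letter words, at the reduct of \<open>x y\<close>.  Working with such values instead of elements of the free
  algebra turns the overlap computations into identities in the field.\<close>

definition swap :: "'k::field \<Rightarrow> nat \<times> nat \<Rightarrow> nat \<times> nat \<Rightarrow> (nat \<times> nat \<Rightarrow> nat \<times> nat \<Rightarrow> 'k) \<Rightarrow> 'k" where
  "swap q x y \<psi> =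
    (if fst x = fst y then \<psi> y x
     else if snd x \<le> snd y then q * \<psi> y x
     else \<psi> y x + (q - 1) * \<psi> (fst y, snd x) (fst x, snd y))"

text \<open>As a congruence rule for function definitions it tells the termination proof of
  \<open>normal_coeff\<close> at which pairs the recursive calls occur. The guard on the rows
  matters: for equal rows the crossed pair would be the original pair again.\<close>

lemma swap_cong [fundef_cong]:
  assumes "q = q'" "x = x'" "y = y'"
    and "\<And>u v. (u, v) = (y', x') \<or>
          fst x' \<noteq> fst y' \<and> (u, v) = ((fst y', snd x'), (fst x', snd y')) \<Longrightarrow> \<psi> u v = \<psi>' u v"
  shows "swap q x y \<psi> = swap q' x' y' \<psi>'"
  using assms by (simp add: swap_def)

text \<open>Both sides expand to the same combination of values of \<open>\<psi>\<close>; this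
  settles descents at disjoint positions.\<close>

lemma swap_commute:
  "swap q x y (\<lambda>u v. swap q x' y' (\<lambda>u' v'. \<psi> u v u' v')) =
   swap q x' y' (\<lambda>u' v'. swap q x y (\<lambda>u v. \<psi> u v u' v'))"
  by (simp add: swap_def algebra_simps)

lemma dlex_context:
  assumes "(u, v) \<in> dlex" "length u = length v"
  shows "(a @ u @ b, a @ v @ b) \<in> dlex"
  using assms by (auto simp: dlex_def lenlex_conv intro: lex_append_leftI lex_append_rightI)

lemma dlex_pair:
  assumes "letter_less u x"
  shows "(a @ u # v # b, a @ x # y # b) \<in> dlex"
  using dlex_context[of "[u, v]" "[x, y]" a b] assms
  by (cases u, cases x) (auto simp: dlex_def lenlex_conv letter_less_def)

text \<open>Each reduct begins with a letter smaller than \<open>x\<close>: either \<open>y\<close>,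
  or the letter in the column of \<open>x\<close> and the strictly smaller row of \<open>y\<close>.
  Hence induction hypotheses on smaller words can be used under \<open>swap\<close>.\<close>

lemma swap_cong_dlex:
  assumes "letter_less y x"
    and "\<And>u v. (a @ u # v # b, a @ x # y # b) \<in> dlex \<Longrightarrow> \<psi> u v = \<psi>' u v"
  shows "swap q x y \<psi> = swap q x y \<psi>'"
proof (rule swap_cong)
  fix u v
  assume "(u, v) = (y, x) \<or> fst x \<noteq> fst y \<and> (u, v) = ((fst y, snd x), (fst x, snd y))"
  with assms(1) have "letter_less u x"
    by (auto simp: letter_less_def)
  then show "\<psi> u v = \<psi>' u v"
    by (intro assms(2) dlex_pair)
qed auto

definition descent ::
    "(nat \<times> nat) list \<times> (nat \<times> nat) \<times> (nat \<times> nat) \<times> (nat \<times> nat) list \<Rightarrow> (nat \<times> nat) list \<Rightarrow> bool"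
  where
  "descent d w \<longleftrightarrow> (case d of (a, x, y, b) \<Rightarrow> w = a @ x # y # b \<and> letter_less y x)"

function normal_coeff :: "'k::field \<Rightarrow> (nat \<times> nat) list \<Rightarrow> (nat \<times> nat) list \<Rightarrow> 'k" where
  "normal_coeff q m w =
    (if \<exists>d. descent d w
     then case SOME d. descent d w of (a, x, y, b) \<Rightarrow> swap q x y (\<lambda>u v. normal_coeff q m (a @ u # v # b))
     else if w = m then 1 else 0)"
  by pat_completeness auto
termination
proof (relation "inv_image dlex (\<lambda>(q, m, w). w)")
  show "wf (inv_image dlex (\<lambda>(q :: 'k, m :: (nat \<times> nat) list, w). w))"
    using wf_dlex by blast
next
  fix q :: 'k and m w a d' x d'' y b u v
  assume "\<exists>d. descent d w" and d: "(a, d') = (SOME d. descent d w)" "(x, d'') = d'" "(y, b) = d''"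
    and uv: "(u, v) = (y, x) \<or> fst x \<noteq> fst y \<and> (u, v) = ((fst y, snd x), fst x, snd y)"
  then have "descent (a, x, y, b) w"
    by (metis someI_ex)
  then have "w = a @ x # y # b" "letter_less y x"
    by (auto simp: descent_def)
  moreover from this uv have "letter_less u x"
    by (auto simp: letter_less_def)
  ultimately show "((q, m, a @ u # v # b), q, m, w) \<in> inv_image dlex (\<lambda>(q, m, w). w)"
    by (simp add: dlex_pair)
qed

declare normal_coeff.simps [simp del]

text \<open>Confluence on overlaps: the two sides rewrite the word first on the left and first on
  the right. Compatibility of \<open>\<psi>\<close> with rewriting is assumed only below
  \<open>[x, y, z]\<close>, which is what well-founded induction supplies.\<close>

lemma swap_overlap:
  assumes "letter_less y x" "letter_less z y"
    and 1: "\<And>a b c. ([a, b, c], [x, y, z]) \<in> dlex \<Longrightarrow> letter_less b a \<Longrightarrow>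
              \<psi> a b c = swap q a b (\<lambda>a b. \<psi> a b c)"
    and 2: "\<And>a b c. ([a, b, c], [x, y, z]) \<in> dlex \<Longrightarrow> letter_less c b \<Longrightarrow>
              \<psi> a b c = swap q b c (\<lambda>b c. \<psi> a b c)"
  shows "swap q x y (\<lambda>a b. \<psi> a b z) = swap q y z (\<lambda>b c. \<psi> x b c)"
proof -
  obtain i j s t u v where [simp]: "x = (i, j)" "y = (s, t)" "z = (u, v)"
    by (cases x, cases y, cases z) auto
  \<comment> \<open>Comparing the first two letters suffices: rewriting on the left lowers the first
    letter, and rewriting on the right keeps the first and lowers the second.\<close>
  have 1: "\<psi> (a, a') (b, b') (c, c') = swap q (a, a') (b, b') (\<lambda>a b. \<psi> a b (c, c'))"
    if "b < a \<or> b = a \<and> b' < a'"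
      "a < i \<or> a = i \<and> a' < j \<or> a = i \<and> a' = j \<and> (b < s \<or> b = s \<and> b' < t)"
    for a a' b b' c c'
    using that by (intro 1) (auto simp: letter_less_def dlex_def lenlex_conv)
  have 2: "\<psi> (a, a') (b, b') (c, c') = swap q (b, b') (c, c') (\<lambda>b c. \<psi> (a, a') b c)"
    if "c < b \<or> c = b \<and> c' < b'"
      "a < i \<or> a = i \<and> a' < j \<or> a = i \<and> a' = j \<and> (b < s \<or> b = s \<and> b' < t)"
    for a a' b b' c c'
    using that by (intro 2) (auto simp: letter_less_def dlex_def lenlex_conv)
  note lts = assms(1,2)[unfolded letter_less_def, simplified]
  \<comment> \<open>The rows satisfy \<open>i \<ge> s \<ge> u\<close>. Once the equalities among
    them are fixed, only the order of the columns decides which branch of \<open>swap\<close>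
    applies.\<close>
  consider (a) "i = s" "s = u" | (b) "i = s" "u < s" | (c) "s < i" "s = u" | (d) "s < i" "u < s" "u < i"
    using lts by linarith
  then show ?thesis
  proof cases
    case a
    with lts have "j > t" "t > v" "j > v" by auto
    with a show ?thesis by (simp add: 1 2 swap_def)
  next
    case b
    with lts have "j > t" by auto
    consider "v < t" | "v = t" | "t < v" "v < j" | "v = j" | "j < v"
      by linarith
    then show ?thesis
      using b \<open>j > t\<close> by cases (simp_all add: 1 2 swap_def algebra_simps)
  next
    case c
    with lts have "t > v" by auto
    consider "j < v" | "j = v" | "v < j" "j < t" | "j = t" | "t < j"
      by linarith
    then show ?thesis
      using c \<open>t > v\<close> by cases (simp_all add: 1 2 swap_def algebra_simps)
  next
    case d
    then have "i \<noteq> s" "s \<noteq> u" "i \<noteq> u" "s \<noteq> i" "u \<noteq> s" "u \<noteq> i"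
      by auto
    note expand = this 1 2 swap_def
    \<comment> \<open>With three distinct rows the columns are unconstrained: the 13 weak orderings
      of \<open>j\<close>, \<open>t\<close>, \<open>v\<close>, six of them strict.\<close>
    consider "j < t" "t < v" "j < v" | "j < v" "v < t" "j < t" | "t < j" "j < v" "t < v"
      | "t < v" "v < j" "t < j" | "v < j" "j < t" "v < t" | "v < t" "t < j" "v < j"
      | "j = t" "t < v" | "j = t" "v < t" | "j = v" "j < t" | "j = v" "t < j"
      | "t = v" "j < t" | "t = v" "t < j" | "j = t" "t = v"
      by (cases j t rule: linorder_cases; cases t v rule: linorder_cases; cases j v rule: linorder_cases;
          (blast | linarith))
    then show ?thesis
      using d by cases (simp_all add: expand, simp_all add: algebra_simps)
  qed
qed

text \<open>The recursion unfolds at one chosen descent; that any other descent gives the same value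
  is proved by induction along \<open>dlex\<close>, comparing two descents of the same word.\<close>

lemma normal_coeff_descent:
  assumes "letter_less y x"
  shows "normal_coeff q m (a @ x # y # b) = swap q x y (\<lambda>u v. normal_coeff q m (a @ u # v # b))"
  using assms
proof (induction "a @ x # y # b" arbitrary: a x y b rule: wf_induct_rule[OF wf_dlex])
  case (1 a x y b)
  let ?N = "normal_coeff q m"
  have IH: "?N w = swap q x' y' (\<lambda>u v. ?N (a' @ u # v # b'))"
    if "(w, a @ x # y # b) \<in> dlex" "w = a' @ x' # y' # b'" "letter_less y' x'" for w a' x' y' b'
    using 1(1) that by blast
  \<comment> \<open>It is enough to treat the first descent as the one further left; exchanging the
    roles covers the other order.\<close>
  have agree: "swap q x1 y1 (\<lambda>u v. ?N (a1 @ u # v # b1)) = swap q x2 y2 (\<lambda>u v. ?N (a2 @ u # v # b2))"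
    if w1: "a @ x # y # b = a1 @ x1 # y1 # b1" and w2: "a @ x # y # b = a2 @ x2 # y2 # b2"
      and less: "letter_less y1 x1" "letter_less y2 x2" and len: "length a1 \<le> length a2"
    for a1 x1 y1 b1 a2 x2 y2 b2
  proof -
    obtain c where c: "a2 = a1 @ c" "x1 # y1 # b1 = c @ x2 # y2 # b2"
      using w1 w2 len by (auto simp: append_eq_append_conv2 append_eq_append_conv_if)
    \<comment> \<open>The offset \<open>c\<close> between the descents has length 0, 1 or at least
      2: they coincide, overlap in one letter, or are disjoint.\<close>
    consider "c = []" | "c = [x1]" "y1 = x2" "b1 = y2 # b2"
      | d where "c = x1 # y1 # d" "b1 = d @ x2 # y2 # b2"
      using c(2) by (auto simp: Cons_eq_append_conv)
    then show ?thesis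
    proof cases
      case 1
      with c show ?thesis by simp
    next
      case 2
      let ?\<psi> = "\<lambda>u v z. ?N (a1 @ u # v # z # b2)"
      have ctx: "(a1 @ u # v # z # b2, a @ x # y # b) \<in> dlex"
        if "([u, v, z], [x1, y1, y2]) \<in> dlex" for u v z
        using dlex_context[OF that, of a1 b2] 2 w1 by simp
      have "swap q x1 y1 (\<lambda>u v. ?\<psi> u v y2) = swap q y1 y2 (\<lambda>u v. ?\<psi> x1 u v)"
      proof (rule swap_overlap)
        fix u v z
        assume "([u, v, z], [x1, y1, y2]) \<in> dlex" "letter_less v u"
        then show "?\<psi> u v z = swap q u v (\<lambda>u v. ?\<psi> u v z)"
          by (intro IH ctx) auto
      next
        fix u v z
        assume "([u, v, z], [x1, y1, y2]) \<in> dlex" "letter_less z v"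
        then show "?\<psi> u v z = swap q v z (\<lambda>v z. ?\<psi> u v z)"
          using IH[OF ctx, of u v z "a1 @ [u]" v z b2] by simp
      qed (use less 2 in auto)
      with 2 c show ?thesis by simp
    next
      case 3
      \<comment> \<open>After one descent is rewritten the other is still present in a smaller word,
        so the induction hypothesis rewrites it too; the two orders then commute.\<close>
      have "swap q x1 y1 (\<lambda>u v. ?N (a1 @ u # v # b1)) =
            swap q x1 y1 (\<lambda>u v. swap q x2 y2 (\<lambda>u' v'. ?N (a1 @ u # v # d @ u' # v' # b2)))"
      proof (rule swap_cong_dlex[OF less(1), where a = a1 and b = b1])
        fix u v
        assume "(a1 @ u # v # b1, a1 @ x1 # y1 # b1) \<in> dlex"
        then show "?N (a1 @ u # v # b1) = swap q x2 y2 (\<lambda>u' v'. ?N (a1 @ u # v # d @ u' # v' # b2))"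
          using IH[of "a1 @ u # v # b1" "a1 @ u # v # d" x2 y2 b2] w1 3 less by simp
      qed
      also have "\<dots> = swap q x2 y2 (\<lambda>u' v'. swap q x1 y1 (\<lambda>u v. ?N (a1 @ u # v # d @ u' # v' # b2)))"
        by (rule swap_commute)
      also have "\<dots> = swap q x2 y2 (\<lambda>u v. ?N (a2 @ u # v # b2))"
      proof (rule swap_cong_dlex[OF less(2), where a = a2 and b = b2, symmetric])
        fix u v
        assume "(a2 @ u # v # b2, a2 @ x2 # y2 # b2) \<in> dlex"
        then show "?N (a2 @ u # v # b2) = swap q x1 y1 (\<lambda>u' v'. ?N (a1 @ u' # v' # d @ u # v # b2))"
          using IH[of "a2 @ u # v # b2" a1 x1 y1 "d @ u # v # b2"] w2 3 c less by simp
      qed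
      finally show ?thesis .
    qed
  qed
  obtain a' x' y' b' where d: "(SOME d. descent d (a @ x # y # b)) = (a', x', y', b')"
    by (metis prod.exhaust)
  have ex: "\<exists>d. descent d (a @ x # y # b)"
    using 1(2) by (intro exI[of _ "(a, x, y, b)"]) (simp add: descent_def)
  then have "descent (a', x', y', b') (a @ x # y # b)"
    by (metis d someI_ex)
  then have d': "a @ x # y # b = a' @ x' # y' # b'" "letter_less y' x'"
    by (auto simp: descent_def)
  have "?N (a @ x # y # b) = swap q x' y' (\<lambda>u v. ?N (a' @ u # v # b'))"
    by (subst normal_coeff.simps, subst if_P[OF ex]) (simp add: d)
  also have "\<dots> = swap q x y (\<lambda>u v. ?N (a @ u # v # b))"
    using agree[OF d'(1) refl d'(2) 1(2)] agree[OF refl d'(1) 1(2) d'(2)] by (metis nat_le_linear)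
  finally show ?case .
qed

lemma normal_coeff_normal:
  "\<nexists>d. descent d w \<Longrightarrow> normal_coeff q m w = (if w = m then 1 else 0)"
  by (subst normal_coeff.simps) simp

text \<open>Rewriting only lowers words, so a word below \<open>m\<close> never reaches
  \<open>m\<close>.\<close>

lemma normal_coeff_below:
  assumes "(w, m) \<in> dlex"
  shows "normal_coeff q m w = 0"
  using assms
proof (induction w rule: wf_induct_rule[OF wf_dlex])
  case (1 w)
  show ?case
  proof (cases "\<exists>d. descent d w")
    case True
    then obtain a x y b where w: "w = a @ x # y # b" "letter_less y x"
      by (auto simp: descent_def)
    have "swap q x y (\<lambda>u v. normal_coeff q m (a @ u # v # b)) = swap q x y (\<lambda>u v. 0)"
      using w 1 by (intro swap_cong_dlex[where a = a and b = b]) (auto intro: transD[OF trans_dlex])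
    with w show ?thesis
      by (simp add: normal_coeff_descent swap_def)
  next
    case False
    then show ?thesis
      using 1(2) wf_not_refl[OF wf_dlex] by (auto simp: normal_coeff_normal)
  qed
qed

section \<open>Linear functionals vanishing on the ideal\<close>

definition normal_functional :: "'k::field \<Rightarrow> (nat \<times> nat) list \<Rightarrow> ((nat \<times> nat) list \<Rightarrow>\<^sub>0 'k) \<Rightarrow> 'k" where
  "normal_functional q m f = (\<Sum>w\<in>Poly_Mapping.keys f. Poly_Mapping.lookup f w * normal_coeff q m w)"

lemma normal_functional_superset:
  assumes "finite A" "Poly_Mapping.keys f \<subseteq> A"
  shows "normal_functional q m f = (\<Sum>w\<in>A. Poly_Mapping.lookup f w * normal_coeff q m w)"
  unfolding normal_functional_def
  using assms by (intro sum.mono_neutral_left) (auto simp: in_keys_iff)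

lemma normal_functional_add:
  "normal_functional q m (f + g) = normal_functional q m f + normal_functional q m g"
proof -
  let ?A = "Poly_Mapping.keys f \<union> Poly_Mapping.keys g"
  have "normal_functional q m h = (\<Sum>w\<in>?A. Poly_Mapping.lookup h w * normal_coeff q m w)"
    if "Poly_Mapping.keys h \<subseteq> ?A" for h
    using that by (intro normal_functional_superset) auto
  then show ?thesis
    by (simp add: Poly_Mapping.keys_add lookup_add distrib_right sum.distrib)
qed

lemma normal_functional_uminus: "normal_functional q m (- f) = - normal_functional q m f"
  by (simp add: normal_functional_def sum_negf)

lemma normal_functional_diff:
  "normal_functional q m (f - g) = normal_functional q m f - normal_functional q m g"
  using normal_functional_add[of q m f "- g"] by (simp add: normal_functional_uminus)

lemma normal_functional_single [simp]:
  "normal_functional q m (Poly_Mapping.single w c) = c * normal_coeff q m w"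
  by (simp add: normal_functional_def)

lemma normal_functional_zero [simp]: "normal_functional q m 0 = 0"
  by (simp add: normal_functional_def)

lemma monomial_products:
  "D i j * D s t = Poly_Mapping.single [(i, j), (s, t)] 1"
  "const c * D i j * D s t = Poly_Mapping.single [(i, j), (s, t)] c"
  by (simp_all add: letter_def const_def mult_single plus_list_def)

lemma rel_expand:
  "f_rel q i j s t = Poly_Mapping.single [(i, j), (s, t)] 1 - Poly_Mapping.single [(s, t), (i, j)] q"
  "g_rel q i j s t = Poly_Mapping.single [(i, j), (s, t)] 1 - Poly_Mapping.single [(s, t), (i, j)] 1
     - Poly_Mapping.single [(s, j), (i, t)] (q - 1)"
  "h_rel i j k = Poly_Mapping.single [(i, j), (i, k)] 1 - Poly_Mapping.single [(i, k), (i, j)] 1"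
  by (simp_all add: f_rel_def g_rel_def h_rel_def monomial_products)

text \<open>Updating at a fresh key is the same as adding a monomial. The rule reduces additive
  claims to monomials.\<close>

lemma poly_mapping_add_induct [case_names single add]:
  fixes f :: "'a \<Rightarrow>\<^sub>0 'b::comm_monoid_add"
  assumes single: "\<And>w c. P (Poly_Mapping.single w c)"
    and add: "\<And>f g. P f \<Longrightarrow> P g \<Longrightarrow> P (f + g)"
  shows "P f"
proof (induction f rule: update_induct)
  case const
  show ?case
    \<comment> \<open>Zero is a monomial with coefficient 0 at an arbitrary exponent.\<close>
    using single[of undefined 0] by simp
next
  case (update f a b)
  have "Poly_Mapping.update a b f = f + Poly_Mapping.single a b"
    using update(1) by (intro poly_mapping_eqI) (auto simp: lookup_update lookup_add lookup_single in_keys_iff when_def)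
  with update(3) show ?case
    by (simp add: add single)
qed

lemma normal_functional_context:
  "normal_functional q m (Poly_Mapping.single a c * f_rel q i j s t * Poly_Mapping.single b d) =
    c * d * (normal_coeff q m (a @ (i, j) # (s, t) # b) - q * normal_coeff q m (a @ (s, t) # (i, j) # b))"
  "normal_functional q m (Poly_Mapping.single a c * g_rel q i j s t * Poly_Mapping.single b d) =
    c * d * (normal_coeff q m (a @ (i, j) # (s, t) # b) - normal_coeff q m (a @ (s, t) # (i, j) # b)
      - (q - 1) * normal_coeff q m (a @ (s, j) # (i, t) # b))"
  "normal_functional q m (Poly_Mapping.single a c * h_rel i j k * Poly_Mapping.single b d) =
    c * d * (normal_coeff q m (a @ (i, j) # (i, k) # b) - normal_coeff q m (a @ (i, k) # (i, j) # b))"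
  by (simp_all add: rel_expand algebra_simps mult_single plus_list_def normal_functional_add normal_functional_diff)

lemma dd_relationsE:
  assumes "r \<in> dd_relations n q"
  obtains (f) i j s t where "r = f_rel q i j s t" "s < i" "j \<le> t"
    | (g) i j s t where "r = g_rel q i j s t" "s < i" "t < j"
    | (h) i j k where "r = h_rel i j k"
  using assms unfolding dd_relations_def
  by (elim UnE CollectE exE conjE) (erule (2) f | erule (2) g | erule h)+

text \<open>By bilinearity \<open>f\<close> and \<open>g\<close> may be taken to be monomials; the
  claim is then the rewriting equation of \<open>normal_coeff\<close> at the descent that the
  relation resolves.\<close>

lemma normal_functional_relation:
  assumes "r \<in> dd_relations n q"
  shows "normal_functional q m (f * r * g) = 0"
proof -
  have monomial: "normal_functional q m (Poly_Mapping.single a c * r * Poly_Mapping.single b d) = 0"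
    for a b c d
  proof -
    from assms show ?thesis
    proof (cases rule: dd_relationsE)
      case (f i j s t)
      with normal_coeff_descent[of "(s, t)" "(i, j)" q m a b] show ?thesis
        by (simp add: normal_functional_context letter_less_def swap_def)
    next
      case (g i j s t)
      with normal_coeff_descent[of "(s, t)" "(i, j)" q m a b] show ?thesis
        by (simp add: normal_functional_context letter_less_def swap_def)
    next
      \<comment> \<open>The columns come in either order: one of the two products is the descent,
        and for \<open>j = k\<close> the relation is zero.\<close>
      case (h i j k)
      with normal_coeff_descent[of "(i, j)" "(i, k)" q m a b]
        normal_coeff_descent[of "(i, k)" "(i, j)" q m a b] show ?thesis
        by (cases j k rule: linorder_cases)
          (simp_all add: normal_functional_context letter_less_def swap_def)
    qed
  qed
  show ?thesis
  proof (induction f rule: poly_mapping_add_induct)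
    case (single a c)
    show ?case
      by (induction g rule: poly_mapping_add_induct)
        (simp_all add: monomial distrib_left normal_functional_add)
  qed (simp add: distrib_right normal_functional_add)
qed

lemma dd_relations_carrier: "dd_relations n q \<subseteq> carrier (free_alg (letters n))"
proof -
  have diff: "f - g \<in> carrier (free_alg (letters n))"
    if "f \<in> carrier (free_alg (letters n))" "g \<in> carrier (free_alg (letters n))"
    for f g :: "(nat \<times> nat) list \<Rightarrow>\<^sub>0 'a"
    using that keys_diff[of f g] by (fastforce simp: free_alg_def)
  have single: "Poly_Mapping.single [(i, j), (s, t)] c \<in> carrier (free_alg (letters n))"
    if "{i, j, s, t} \<subseteq> {1..n}" for i j s t and c :: 'a
    using that by (auto simp: free_alg_def letters_def split: if_splits)
  show ?thesis
    unfolding dd_relations_def rel_expand by (auto intro!: diff single)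
qed

lemma normal_functional_ideal:
  assumes "f \<in> genideal (free_alg (letters n)) (dd_relations n q)"
  shows "normal_functional q m f = 0"
proof -
  let ?R = "free_alg (letters n) :: ((nat \<times> nat) list \<Rightarrow>\<^sub>0 'a) ring"
  \<comment> \<open>Quantifying over all multiples makes the set closed under multiplication from
    both sides, which the kernel alone need not be; \<open>g = h = 1\<close> recovers the kernel
    condition.\<close>
  let ?I = "{f \<in> carrier ?R. \<forall>g h. normal_functional q m (g * f * h) = 0}"
  interpret ring ?R
    by (rule ring_free_alg)
  have "ideal ?I ?R"
  proof (rule idealI[OF ring_axioms])
    have inv: "\<ominus>\<^bsub>?R\<^esub> f = - f" if "f \<in> carrier ?R" for f
      using that by (intro minus_equality) (auto simp: free_alg_def)
    show "subgroup ?I (add_monoid ?R)"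
    proof (rule group.subgroupI[OF add.group_axioms])
      have "0 \<in> ?I"
        by (simp add: free_alg_def)
      then show "?I \<noteq> {}"
        by blast
    next
      fix f
      assume "f \<in> ?I"
      then show "inv\<^bsub>add_monoid ?R\<^esub> f \<in> ?I"
        using a_inv_closed[of f] inv[of f] by (auto simp: a_inv_def normal_functional_uminus)
    next
      fix f g
      assume "f \<in> ?I" "g \<in> ?I"
      then show "f \<otimes>\<^bsub>add_monoid ?R\<^esub> g \<in> ?I"
        using add.m_closed[of f g] by (auto simp: free_alg_def distrib_left distrib_right normal_functional_add)
    qed auto
  next
    fix f g
    assume f: "f \<in> ?I" and g: "g \<in> carrier ?R"
    have "normal_functional q m (h * (g * f) * k) = 0" "normal_functional q m (h * (f * g) * k) = 0" for h k
    proof -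
      have "normal_functional q m ((h * g) * f * k) = 0" "normal_functional q m (h * f * (g * k)) = 0"
        using f by blast+
      then show "normal_functional q m (h * (g * f) * k) = 0" "normal_functional q m (h * (f * g) * k) = 0"
        by (simp_all add: mult.assoc)
    qed
    moreover have "f \<in> carrier ?R"
      using f by blast
    then have "g \<otimes>\<^bsub>?R\<^esub> f \<in> carrier ?R" "f \<otimes>\<^bsub>?R\<^esub> g \<in> carrier ?R"
      using g by (blast intro: m_closed)+
    moreover have "g \<otimes>\<^bsub>?R\<^esub> f = g * f" "f \<otimes>\<^bsub>?R\<^esub> g = f * g"
      by (simp_all add: free_alg_def)
    ultimately show "g \<otimes>\<^bsub>?R\<^esub> f \<in> ?I" "f \<otimes>\<^bsub>?R\<^esub> g \<in> ?I"
      by auto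
  qed
  then have "genideal ?R (dd_relations n q) \<subseteq> ?I"
    using dd_relations_carrier by (intro genideal_minimal) (auto simp: normal_functional_relation)
  with assms have "normal_functional q m (1 * f * 1) = 0"
    by blast
  then show ?thesis by simp
qed

section \<open>Leading words of the relations and of elements of the ideal\<close>

lemma lead_word_eqI:
  assumes "w \<in> Poly_Mapping.keys f" "\<And>v. v \<in> Poly_Mapping.keys f \<Longrightarrow> v \<noteq> w \<Longrightarrow> (v, w) \<in> dlex"
  shows "lead_word dlex f = w"
proof (rule ccontr)
  assume ne: "lead_word dlex f \<noteq> w"
  have "f \<noteq> 0"
    using assms(1) by auto
  from lead_word_dlex[OF this] ne assms show False
    using wf_not_sym[OF wf_dlex] by metis
qed

text \<open>Each way in which \<open>y\<close> can be smaller than \<open>x\<close> belongs to one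
  family of relations, and every other word of that relation begins with a letter smaller than
  \<open>x\<close>.\<close>

lemma dd_relation_lead_word:
  assumes "letter_less y x" "x \<in> letters n" "y \<in> letters n"
  shows "\<exists>s \<in> dd_relations n q. s \<noteq> 0 \<and> lead_word dlex s = [x, y]"
proof -
  obtain i j s t where xy [simp]: "x = (i, j)" "y = (s, t)"
    by (cases x, cases y)
  have witness: ?thesis
    if "r \<in> dd_relations n q" "Poly_Mapping.lookup r [x, y] = 1"
      and keys: "\<And>w. w \<in> Poly_Mapping.keys r \<Longrightarrow> w \<noteq> [x, y] \<Longrightarrow>
            w = [y, x] \<or> s < i \<and> w = [(s, j), (i, t)]" for r
  proof -
    have "lead_word dlex r = [x, y]"
    proof (rule lead_word_eqI)
      fix w
      assume "w \<in> Poly_Mapping.keys r" "w \<noteq> [x, y]"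
      from keys[OF this] show "(w, [x, y]) \<in> dlex"
        using assms(1) dlex_pair[of y x "[]" x "[]" y] dlex_pair[of "(s, j)" x "[]" "(i, t)" "[]" y]
        by (auto simp: letter_less_def)
    qed (use that in \<open>simp add: in_keys_iff\<close>)
    moreover have "r \<noteq> 0"
      using that(2) by auto
    ultimately show ?thesis
      using that(1) by blast
  qed
  have idx: "{i, j, s, t} \<subseteq> {1..n}"
    using assms(2,3) by (auto simp: letters_def)
  note coeffs = rel_expand lookup_minus lookup_single in_keys_iff when_def
  consider "s < i" "j \<le> t" | "s < i" "t < j" | "s = i" "t < j"
    using assms(1) by (fastforce simp: letter_less_def)
  then show ?thesis
  proof cases
    case 1
    with idx have "f_rel q i j s t \<in> dd_relations n q"
      unfolding dd_relations_def by blast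
    then show ?thesis
      by (rule witness) (use 1 in \<open>auto simp: coeffs split: if_splits\<close>)
  next
    case 2
    with idx have "g_rel q i j s t \<in> dd_relations n q"
      unfolding dd_relations_def by blast
    then show ?thesis
      by (rule witness) (use 2 in \<open>auto simp: coeffs split: if_splits\<close>)
  next
    case 3
    have "{i, j, t} \<subseteq> {1..n}"
      using idx by simp
    then have "h_rel i j t \<in> dd_relations n q"
      unfolding dd_relations_def by blast
    then show ?thesis
      by (rule witness) (use 3 in \<open>auto simp: coeffs split: if_splits\<close>)
  qed
qed

theorem theorem2p1:
  fixes q :: "'k::field_char_0" and n :: nat
  assumes "q \<noteq> 0" and "n \<ge> 2"
  shows "gs_basis (letters n) dlex (dd_relations n q)
           (genideal (free_alg (letters n)) (dd_relations n q))"
  unfolding gs_basis_def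
proof (intro conjI ballI impI refl dd_relations_carrier)
  fix f :: "(nat \<times> nat) list \<Rightarrow>\<^sub>0 'k"
  assume f: "f \<in> genideal (free_alg (letters n)) (dd_relations n q)" "f \<noteq> 0"
  let ?m = "lead_word dlex f"
  note lead = lead_word_dlex[OF f(2)]
  have "\<exists>d. descent d ?m"
  proof (rule ccontr)
    assume "\<nexists>d. descent d ?m"
    \<comment> \<open>All other words of \<open>f\<close> lie below the leading word and contribute
      nothing, so the functional returns the nonzero leading coefficient.\<close>
    then have "Poly_Mapping.lookup f w * normal_coeff q ?m w =
        (if w = ?m then Poly_Mapping.lookup f ?m else 0)" if "w \<in> Poly_Mapping.keys f" for w
      using lead(2)[OF that] by (auto simp: normal_coeff_normal normal_coeff_below)
    then have "normal_functional q ?m f = Poly_Mapping.lookup f ?m"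
      using lead(1) by (simp add: normal_functional_def)
    with normal_functional_ideal[OF f(1)] lead(1) show False
      by (simp add: in_keys_iff)
  qed
  then obtain a x y b where m: "?m = a @ [x, y] @ b" "letter_less y x"
    by (auto simp: descent_def)
  interpret ring "free_alg (letters n) :: ((nat \<times> nat) list \<Rightarrow>\<^sub>0 'k) ring"
    by (rule ring_free_alg)
  \<comment> \<open>This confines the letters of the descent to the index range, so that the
    matching relation belongs to \<open>dd_relations n q\<close>.\<close>
  have "f \<in> carrier (free_alg (letters n))"
    using f(1) ideal.Icarr[OF genideal_ideal[OF dd_relations_carrier]] by blast
  then have "set ?m \<subseteq> letters n"
    using lead(1) by (simp add: free_alg_def)
  with m have "x \<in> letters n" "y \<in> letters n"
    by auto
  from dd_relation_lead_word[OF m(2) this] obtain s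
    where "s \<in> dd_relations n q" "s \<noteq> 0" "lead_word dlex s = [x, y]"
    by blast
  with m(1) show "\<exists>s \<in> dd_relations n q. s \<noteq> 0 \<and> sublist (lead_word dlex s) ?m"
    by (metis sublist_appendI)
qed

end
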